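(* Let $(Q_n)_{n\geq 0}$ be the tetranacci numbers, defined by $Q_0=Q_1=Q_2=0$, $Q_3=1$ and $Q_n=Q_{n-1}+Q_{n-2}+Q_{n-3}+Q_{n-4}$ for $n\geq 4$. Then for all integers $n,k\geq 1$, $$Q_{n+k}=Q_{n+2}Q_{k+1}+Q_{n+1}\left(Q_{k+2}-Q_{k+1}\right)+Q_n\left(Q_{k-1}+Q_k\right)+Q_{n-1}Q_k.$$ *)

theory Defs
  imports Main
begin

text \<open>The values are integers so that the subtraction of tetranacci numbers is not truncated.\<close>

fun tetranacci :: "nat \<Rightarrow> int" where
  "tetranacci 0 = 0"
| "tetranacci (Suc 0) = 0"
| "tetranacci (Suc (Suc 0)) = 0"
| "tetranacci (Suc (Suc (Suc 0))) = 1"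
| "tetranacci (Suc (Suc (Suc (Suc n)))) =
     tetranacci (Suc (Suc (Suc n))) + tetranacci (Suc (Suc n)) + tetranacci (Suc n) + tetranacci n"

end

theory Submission
  imports Defs
begin

text \<open>
  The right-hand side is a bilinear form \<open>B n k\<close> in four consecutive tetranacci numbers around
  \<open>n\<close> and four around \<open>k\<close>. Eliminating \<open>Q (n + 3)\<close> from \<open>B (n + 1) k\<close> by the recurrence
  and collecting the coefficients of \<open>Q (n + 2), Q (n + 1), Q n, Q (n - 1)\<close> produces exactly
  \<open>B n (k + 1)\<close>. So \<open>B\<close>, like \<open>Q (n + k)\<close>, depends only on \<open>n + k\<close>, and the two agree at
  \<open>n = 1\<close>, where the initial values \<open>0, 0, 0, 1\<close> leave the single term
  \<open>Q 3 * Q (k + 1)\<close>.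
\<close>

text \<open>
  Writing \<open>n = m + 1\<close> and \<open>k = j + 1\<close> removes the truncated subtractions from the indices.
  The index \<open>j\<close> varies in the induction because a unit is moved from \<open>m\<close> to \<open>j\<close>.
\<close>

lemma tetranacci_add:
  "tetranacci (m + j + 2) =
     tetranacci (m + 3) * tetranacci (j + 2)
   + tetranacci (m + 2) * (tetranacci (j + 3) - tetranacci (j + 2))
   + tetranacci (m + 1) * (tetranacci j + tetranacci (j + 1))
   + tetranacci m * tetranacci (j + 1)"
proof (induction m arbitrary: j)
  case 0
  show ?case by (simp add: numeral_eq_Suc)
next
  case (Suc m)
  show ?case using Suc.IH[of "Suc j"] by (simp add: numeral_eq_Suc algebra_simps)
qed

theorem corollary7:
  fixes n k :: nat
  assumes "n \<ge> 1" and "k \<ge> 1"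
  shows "tetranacci (n + k) =
           tetranacci (n + 2) * tetranacci (k + 1)
         + tetranacci (n + 1) * (tetranacci (k + 2) - tetranacci (k + 1))
         + tetranacci n * (tetranacci (k - 1) + tetranacci k)
         + tetranacci (n - 1) * tetranacci k"
proof -
  obtain m j where "n = Suc m" "k = Suc j"
    using assms by (metis One_nat_def Suc_le_D)
  then show ?thesis
    using tetranacci_add[of m j] by (simp add: numeral_eq_Suc)
qed

end
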